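(* Consider the problem $f_*=\min_{x\in Q}f(x)>-\infty$, where $Q\subseteq\operatorname{dom} f\subseteq\mathbb{E}$ is a closed convex set and $f$ is a differentiable (not necessarily convex) function satisfying the Regularity Assumption. Let the method GGM (described in the context) be started from $x_0\in Q$ with $M_0>0$ and accuracy $\delta>0$, and let $\Delta_0=f(x_0)-f_*$. Assume that $M_0\le\hat\gamma_f(\Delta_0)$ and that the integer $N\ge1$ satisfies $$\Delta_0\ >\ N\,\hat\sigma\Big(2^{5/2}\,\frac{\Delta_0}{N\delta}\Big).$$ Then the termination criterion of GGM is activated at some iteration $\bar k\le N$. Moreover, for all $k$ with $0\le k\le\bar k$, $$M_k\ \le\ \hat\gamma_f(\epsilon_N),\qquad \epsilon_N=\frac{2\Delta_0}{N}.$$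
   Context: $\mathbb{E}$ is a finite-dimensional real linear space with dual $\mathbb{E}^*$, $\langle g,x\rangle$ is the value of $g\in\mathbb{E}^*$ at $x$. The norm is Euclidean: $\|x\|=\langle Bx,x\rangle^{1/2}$ with $B=B^*:\mathbb{E}\to\mathbb{E}^*$ positive definite, and $\|g\|_*=\max\{\langle g,x\rangle:\|x\|\le1\}=\langle g,B^{-1}g\rangle^{1/2}$. The function $f$ has convex domain, is not affine, and $\nabla f(x)\in\mathbb{E}^*$ is its gradient. Global Curvature Bound: $$\hat\mu(t)=\sup_{x,y\in\operatorname{dom} f,\ \alpha\in(0,1)}\Big\{\frac{|\alpha f(x)+(1-\alpha)f(y)-f(\alpha x+(1-\alpha)y)|}{\alpha(1-\alpha)}:\ \|x-y\|\le t\Big\}.$$ Let $D=\operatorname{diam}(\operatorname{dom} f)$; $\Gamma=[0,D]$ if $D<+\infty$, $\Gamma=[0,+\infty)$ otherwise. Regularity Assumption: $\hat\mu(t)$ is finite for all $t\in\Gamma$ and $\lim_{\tau\to+0}\frac1\tau\hat\mu(\tau)=0$. For $r\in\Gamma$: $\hat\sigma(r)=\int_0^r\frac1\tau\hat\mu(\tau)d\tau$. Let $\hat s_f$ be the inverse function of $\hat\sigma$: $\hat\sigma(\hat s_f(\epsilon))=\epsilon$ for $\epsilon\in\hat\sigma(\Gamma)$. For $t\in2\hat\sigma(\Gamma)$, $t>0$: $\hat\gamma_f(t)=2t/\hat s_f^2(t/2)$. All quantities in the claim are assumed to be defined, i.e. $\Delta_0>0$, $\Delta_0\in2\hat\sigma(\Gamma)$,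 $\epsilon_N\in2\hat\sigma(\Gamma)$ and $2^{5/2}\Delta_0/(N\delta)\in\Gamma$. For $\bar x\in Q$, $M>0$: $\mathcal{T}_M(\bar x)=\operatorname{arg\,min}_{x\in Q}\{f(\bar x)+\langle\nabla f(\bar x),x-\bar x\rangle+\frac12M\|x-\bar x\|^2\}$. Universal General Gradient Method (GGM). Choose $x_0\in Q$, $M_0>0$, $\delta>0$. For $k\ge0$ do: 1. Starting from $i=0$, perform: (a) compute $x_k^i=\mathcal{T}_{2^iM_k}(x_k)$ and $g_k^i=2^iM_kB(x_k-x_k^i)$; (b) (termination criterion) if $\|g_k^i\|_*\le\delta$, then stop and output $\bar x=x_k^i$, $\bar M=2^iM_k$; (c) check the inequality $f(x_k)-f(x_k^i)\ge2^{i-2}M_k\|x_k^i-x_k\|^2$; (d) if it holds, set $i_k=i$ and go to Step 2; otherwise set $i:=i+1$ and repeat. 2. Set $x_{k+1}=x_k^{i_k}$ and $M_{k+1}=2^{i_k-1}M_k$.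
   Formalization: For N=1 the formal theorem additionally assumes M_0 ≤ γ̂_f(ε_N); without it the claim fails (e.g. f(x)=|x|^{3/2} on the real line, x_0=1, M_0=γ̂_f(Δ_0), δ large: M_0 > γ̂_f(2Δ_0)). For N≥2 nothing is added. *)

theory Defs
  imports "HOL-Analysis.Analysis"
begin

text \<open>
  The space \<open>E\<close> is a type of class \<open>euclidean_space\<close> and its dual is \<open>'a \<Rightarrow>\<^sub>L real\<close>, so that
  \<open>\<langle>g, x\<rangle>\<close> is \<open>blinfun_apply g x\<close>. The class supplies the (canonical) topology only: all lengths
  are measured in the norm given by the operator \<open>B\<close>, not in the norm of the class.
\<close>

definition positive_definite_op :: "('a::euclidean_space \<Rightarrow> 'a \<Rightarrow>\<^sub>L real) \<Rightarrow> bool" where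
  "positive_definite_op B \<longleftrightarrow>
     linear B \<and>
     (\<forall>x y. blinfun_apply (B x) y = blinfun_apply (B y) x) \<and>
     (\<forall>x. x \<noteq> 0 \<longrightarrow> blinfun_apply (B x) x > 0)"

definition primal_norm :: "('a::euclidean_space \<Rightarrow> 'a \<Rightarrow>\<^sub>L real) \<Rightarrow> 'a \<Rightarrow> real" where
  "primal_norm B x = sqrt (blinfun_apply (B x) x)"

definition dual_norm :: "('a::euclidean_space \<Rightarrow> 'a \<Rightarrow>\<^sub>L real) \<Rightarrow> ('a \<Rightarrow>\<^sub>L real) \<Rightarrow> real" where
  "dual_norm B g = (SUP x\<in>{x. primal_norm B x \<le> 1}. blinfun_apply g x)"

text \<open>
  In the following, \<open>D\<close> is the domain of \<open>f\<close>; the values of \<open>f\<close> outside \<open>D\<close> are irrelevant.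
\<close>

definition affine_fun_on :: "'a::euclidean_space set \<Rightarrow> ('a \<Rightarrow> real) \<Rightarrow> bool" where
  "affine_fun_on D f \<longleftrightarrow> (\<exists>(g :: 'a \<Rightarrow>\<^sub>L real) c. \<forall>x\<in>D. f x = blinfun_apply g x + c)"

text \<open>The global curvature bound; it takes values in \<open>ereal\<close> because it may be infinite.\<close>

definition mu_hat ::
  "('a::euclidean_space \<Rightarrow> 'a \<Rightarrow>\<^sub>L real) \<Rightarrow> 'a set \<Rightarrow> ('a \<Rightarrow> real) \<Rightarrow> real \<Rightarrow> ereal" where
  "mu_hat B D f t =
     (SUP (x, y, \<alpha>) \<in> {(x, y, \<alpha>). x \<in> D \<and> y \<in> D \<and> 0 < \<alpha> \<and> \<alpha> < 1 \<and> primal_norm B (x - y) \<le> t}.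
        ereal (\<bar>\<alpha> * f x + (1 - \<alpha>) * f y - f (\<alpha> *\<^sub>R x + (1 - \<alpha>) *\<^sub>R y)\<bar> / (\<alpha> * (1 - \<alpha>))))"

definition diam :: "('a::euclidean_space \<Rightarrow> 'a \<Rightarrow>\<^sub>L real) \<Rightarrow> 'a set \<Rightarrow> ereal" where
  "diam B D = (SUP (x, y) \<in> D \<times> D. ereal (primal_norm B (x - y)))"

text \<open>\<open>[0, diam]\<close> if the diameter is finite, and \<open>[0, \<infinity>)\<close> otherwise.\<close>

definition Gamma_set :: "('a::euclidean_space \<Rightarrow> 'a \<Rightarrow>\<^sub>L real) \<Rightarrow> 'a set \<Rightarrow> real set" where
  "Gamma_set B D = {t. 0 \<le> t \<and> ereal t \<le> diam B D}"

definition regularity_assumption ::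
  "('a::euclidean_space \<Rightarrow> 'a \<Rightarrow>\<^sub>L real) \<Rightarrow> 'a set \<Rightarrow> ('a \<Rightarrow> real) \<Rightarrow> bool" where
  "regularity_assumption B D f \<longleftrightarrow>
     (\<forall>t\<in>Gamma_set B D. \<bar>mu_hat B D f t\<bar> \<noteq> \<infinity>) \<and>
     ((\<lambda>\<tau>. mu_hat B D f \<tau> / ereal \<tau>) \<longlongrightarrow> 0) (at_right 0)"

definition sigma_hat ::
  "('a::euclidean_space \<Rightarrow> 'a \<Rightarrow>\<^sub>L real) \<Rightarrow> 'a set \<Rightarrow> ('a \<Rightarrow> real) \<Rightarrow> real \<Rightarrow> real" where
  "sigma_hat B D f r = integral {0..r} (\<lambda>\<tau>. real_of_ereal (mu_hat B D f \<tau>) / \<tau>)"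

definition s_hat ::
  "('a::euclidean_space \<Rightarrow> 'a \<Rightarrow>\<^sub>L real) \<Rightarrow> 'a set \<Rightarrow> ('a \<Rightarrow> real) \<Rightarrow> real \<Rightarrow> real" where
  "s_hat B D f = the_inv_into (Gamma_set B D) (sigma_hat B D f)"

definition gamma_hat ::
  "('a::euclidean_space \<Rightarrow> 'a \<Rightarrow>\<^sub>L real) \<Rightarrow> 'a set \<Rightarrow> ('a \<Rightarrow> real) \<Rightarrow> real \<Rightarrow> real" where
  "gamma_hat B D f t = 2 * t / (s_hat B D f (t / 2))\<^sup>2"

text \<open>The set \<open>2 \<sigma>(\<Gamma>)\<close> of arguments (the positive ones) for which \<open>gamma_hat\<close> is meaningful.\<close>

definition gamma_dom ::
  "('a::euclidean_space \<Rightarrow> 'a \<Rightarrow>\<^sub>L real) \<Rightarrow> 'a set \<Rightarrow> ('a \<Rightarrow> real) \<Rightarrow> real set" where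
  "gamma_dom B D f = (\<lambda>r. 2 * sigma_hat B D f r) ` Gamma_set B D"

text \<open>
  The gradient step. \<open>df\<close> is the gradient mapping of \<open>f\<close>. The objective is strongly convex, so on
  a nonempty closed convex set \<open>Q\<close> the minimizer exists and is unique.
\<close>

definition grad_step ::
  "('a::euclidean_space \<Rightarrow> 'a \<Rightarrow>\<^sub>L real) \<Rightarrow> 'a set \<Rightarrow> ('a \<Rightarrow> real) \<Rightarrow> ('a \<Rightarrow> 'a \<Rightarrow>\<^sub>L real)
     \<Rightarrow> real \<Rightarrow> 'a \<Rightarrow> 'a" where
  "grad_step B Q f df M z =
     arg_min_on (\<lambda>x. f z + blinfun_apply (df z) (x - z) + 1 / 2 * M * (primal_norm B (x - z))\<^sup>2) Q"

text \<open>The tests made in the \<open>i\<close>-th inner iteration when \<open>x\<^sub>k = x\<close> and \<open>M\<^sub>k = M\<close>.\<close>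

definition ggm_stop ::
  "('a::euclidean_space \<Rightarrow> 'a \<Rightarrow>\<^sub>L real) \<Rightarrow> 'a set \<Rightarrow> ('a \<Rightarrow> real) \<Rightarrow> ('a \<Rightarrow> 'a \<Rightarrow>\<^sub>L real)
     \<Rightarrow> real \<Rightarrow> 'a \<Rightarrow> real \<Rightarrow> nat \<Rightarrow> bool" where
  "ggm_stop B Q f df \<delta> x M i \<longleftrightarrow>
     dual_norm B ((2 ^ i * M) *\<^sub>R B (x - grad_step B Q f df (2 ^ i * M) x)) \<le> \<delta>"

definition ggm_accept ::
  "('a::euclidean_space \<Rightarrow> 'a \<Rightarrow>\<^sub>L real) \<Rightarrow> 'a set \<Rightarrow> ('a \<Rightarrow> real) \<Rightarrow> ('a \<Rightarrow> 'a \<Rightarrow>\<^sub>L real)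
     \<Rightarrow> 'a \<Rightarrow> real \<Rightarrow> nat \<Rightarrow> bool" where
  "ggm_accept B Q f df x M i \<longleftrightarrow>
     f x - f (grad_step B Q f df (2 ^ i * M) x)
       \<ge> 2 powi (int i - 2) * M * (primal_norm B (grad_step B Q f df (2 ^ i * M) x - x))\<^sup>2"

text \<open>
  \<open>ggm_reach B Q f df \<delta> x0 M0 k i x M\<close>: the run of the method started from \<open>x0\<close>, \<open>M0\<close> arrives at
  inner iteration \<open>i\<close> of outer iteration \<open>k\<close>, and \<open>x\<^sub>k = x\<close>, \<open>M\<^sub>k = M\<close>. The run is deterministic, so
  \<open>x\<close> and \<open>M\<close> are determined by \<open>k\<close>; it has no successor state once the termination criterion holds.
\<close>

inductive ggm_reach ::
  "('a::euclidean_space \<Rightarrow> 'a \<Rightarrow>\<^sub>L real) \<Rightarrow> 'a set \<Rightarrow> ('a \<Rightarrow> real) \<Rightarrow> ('a \<Rightarrow> 'a \<Rightarrow>\<^sub>L real)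
     \<Rightarrow> real \<Rightarrow> 'a \<Rightarrow> real \<Rightarrow> nat \<Rightarrow> nat \<Rightarrow> 'a \<Rightarrow> real \<Rightarrow> bool"
  for B Q f df \<delta> x0 M0 where
  start: "ggm_reach B Q f df \<delta> x0 M0 0 0 x0 M0"
| retry: "ggm_reach B Q f df \<delta> x0 M0 k i x M \<Longrightarrow>
    \<not> ggm_stop B Q f df \<delta> x M i \<Longrightarrow> \<not> ggm_accept B Q f df x M i \<Longrightarrow>
    ggm_reach B Q f df \<delta> x0 M0 k (Suc i) x M"
| advance: "ggm_reach B Q f df \<delta> x0 M0 k i x M \<Longrightarrow>
    \<not> ggm_stop B Q f df \<delta> x M i \<Longrightarrow> ggm_accept B Q f df x M i \<Longrightarrow>
    ggm_reach B Q f df \<delta> x0 M0 (Suc k) 0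
      (grad_step B Q f df (2 ^ i * M) x) (2 powi (int i - 1) * M)"

definition ggm_stops_at ::
  "('a::euclidean_space \<Rightarrow> 'a \<Rightarrow>\<^sub>L real) \<Rightarrow> 'a set \<Rightarrow> ('a \<Rightarrow> real) \<Rightarrow> ('a \<Rightarrow> 'a \<Rightarrow>\<^sub>L real)
     \<Rightarrow> real \<Rightarrow> 'a \<Rightarrow> real \<Rightarrow> nat \<Rightarrow> bool" where
  "ggm_stops_at B Q f df \<delta> x0 M0 k \<longleftrightarrow>
     (\<exists>i x M. ggm_reach B Q f df \<delta> x0 M0 k i x M \<and> ggm_stop B Q f df \<delta> x M i)"

end

theory Submission
  imports Defs
begin

text \<open>
  Write \<open>\<mu>\<close> and \<open>\<sigma>\<close> for the global curvature bound and its integral \<open>\<integral> \<mu>(\<tau>)/\<tau> d\<tau>\<close>. Everything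
  rests on three properties of them.

  First, \<open>\<mu>(t)/t\<^sup>2\<close> is nonincreasing (lemma \<open>mu_subquadratic\<close>): the interpolation error on a
  long segment is controlled by the errors on two overlapping shorter ones. Integrating,
  \<open>\<sigma>(r)/r\<^sup>2\<close> is nonincreasing and \<open>\<mu>(r) \<le> 2 \<sigma>(r)\<close> (lemmas \<open>sig_subquadratic\<close> and
  \<open>modulus_le_sig\<close>). Hence \<open>gamma_hat\<close>, which at \<open>2 \<sigma>(r)\<close> takes the value \<open>4 \<sigma>(r)/r\<^sup>2\<close>, is
  nonincreasing as well.

  Second, letting \<open>\<alpha> \<rightarrow> 0\<close> in the definition of \<open>\<mu>\<close> bounds the linearization error of \<open>f\<close> at distance
  \<open>r\<close> by \<open>\<mu>(r)\<close>, so by \<open>2 \<sigma>(r)\<close> (lemma \<open>upper_model\<close>). This also shows that \<open>\<mu>\<close> is positive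
  off \<open>0\<close>, since otherwise \<open>f\<close> would be affine; so \<open>\<sigma>\<close> is injective.

  Third, let \<open>\<sigma>(\<rho>) = E = \<Delta>\<^sub>0/N\<close> and \<open>\<gamma> = 4 E/\<rho>\<^sup>2\<close>, which is \<open>gamma_hat\<close> at \<open>\<epsilon>\<^sub>N\<close>. The hypothesis
  on \<open>N\<close> says that \<open>\<rho>\<close> exceeds \<open>2\<^bsup>5/2\<^esup> E/\<delta>\<close>, equivalently \<open>\<delta>\<^sup>2 > 8 E \<gamma>\<close>. A trial with constant \<open>L\<close> and
  step length \<open>r\<close> gives a decrease of at least \<open>L r\<^sup>2 - 2 \<sigma>(r)\<close>, while \<open>L r > \<delta>\<close> as long as the
  termination criterion fails. If \<open>\<gamma> < L \<le> 2 \<gamma>\<close>, the trial is accepted: for \<open>r \<ge> \<rho>\<close> because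
  \<open>\<sigma>(r)/r\<^sup>2 \<le> \<gamma>/4\<close>, and for \<open>r < \<rho>\<close> because \<open>\<sigma>(r) \<le> E < \<delta>\<^sup>2/(8 \<gamma>) < (L r)\<^sup>2/(8 \<gamma>) \<le> L r\<^sup>2/4\<close>.
  Since trial constants only double, no trial constant ever exceeds \<open>2 \<gamma>\<close> and no \<open>M\<^sub>k\<close> exceeds \<open>\<gamma>\<close>.
  Finally an accepted trial decreases \<open>f\<close> by at least \<open>L r\<^sup>2/4 > \<delta>\<^sup>2/(8 \<gamma>) > E\<close>, so \<open>N\<close>
  complete iterations would push \<open>f\<close> below its infimum.
\<close>

section \<open>The inner product given by B\<close>

locale pd_operator =
  fixes B :: "'a::euclidean_space \<Rightarrow> 'a \<Rightarrow>\<^sub>L real"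
  assumes pd: "positive_definite_op B"
begin

lemma linear_B: "linear B"
  and B_commute: "blinfun_apply (B x) y = blinfun_apply (B y) x"
  and B_pos: "x \<noteq> 0 \<Longrightarrow> blinfun_apply (B x) x > 0"
  using pd by (auto simp: positive_definite_op_def)

lemma B_nonneg: "blinfun_apply (B x) x \<ge> 0"
  using B_pos[of x] by (cases "x = 0") (auto simp: linear_0[OF linear_B])

lemmas B_simps =
  linear_add[OF linear_B] linear_diff[OF linear_B] linear_cmul[OF linear_B]
  linear_0[OF linear_B] linear_neg[OF linear_B]
  blinfun.add_left blinfun.diff_left blinfun.scaleR_left blinfun.minus_left
  blinfun.add_right blinfun.diff_right blinfun.scaleR_right blinfun.minus_right

lemma primal_norm_square: "(primal_norm B x)\<^sup>2 = blinfun_apply (B x) x"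
  by (simp add: primal_norm_def B_nonneg)

lemma primal_norm_nonneg: "primal_norm B x \<ge> 0"
  by (simp add: primal_norm_def B_nonneg)

lemma primal_norm_scaleR: "primal_norm B (c *\<^sub>R x) = \<bar>c\<bar> * primal_norm B x"
  by (simp add: primal_norm_def B_simps real_sqrt_mult mult.assoc[symmetric]
      flip: power2_eq_square)

lemma primal_norm_commute: "primal_norm B (x - y) = primal_norm B (y - x)"
  using primal_norm_scaleR[of "-1" "x - y"] by simp

lemma B_Cauchy_Schwarz: "blinfun_apply (B x) y \<le> primal_norm B x * primal_norm B y"
proof (cases "x = 0")
  case True
  then show ?thesis by (simp add: B_simps primal_norm_def)
next
  case False
  let ?p = "blinfun_apply (B x) x" and ?q = "blinfun_apply (B y) y"
    and ?b = "blinfun_apply (B x) y"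
  have "0 \<le> blinfun_apply (B (?p *\<^sub>R y - ?b *\<^sub>R x)) (?p *\<^sub>R y - ?b *\<^sub>R x)"
    by (rule B_nonneg)
  also have "\<dots> = ?p * (?p * ?q - ?b\<^sup>2)"
    by (simp add: B_simps B_commute[of y x] algebra_simps power2_eq_square)
  finally have "?b\<^sup>2 \<le> (primal_norm B x * primal_norm B y)\<^sup>2"
    using B_pos[OF False]
    by (simp add: power_mult_distrib primal_norm_square zero_le_mult_iff)
  then show ?thesis
    by (rule power2_le_imp_le) (simp add: primal_norm_nonneg)
qed

text \<open>
  By this bound a failed termination test forces a long step: the tested covector has the form
  \<open>c B h\<close>, where \<open>h\<close> is the step up to sign.
\<close>

lemma dual_norm_B_le:
  assumes "c \<ge> 0"
  shows "dual_norm B (c *\<^sub>R B h) \<le> c * primal_norm B h"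
  unfolding dual_norm_def
proof (rule cSUP_least)
  have "primal_norm B 0 \<le> 1"
    by (simp add: primal_norm_def B_simps)
  then show "{x. primal_norm B x \<le> 1} \<noteq> {}"
    by blast
next
  fix x assume "x \<in> {x. primal_norm B x \<le> 1}"
  then have "primal_norm B h * primal_norm B x \<le> primal_norm B h * 1"
    by (intro mult_left_mono) (auto simp: primal_norm_nonneg)
  with B_Cauchy_Schwarz[of h x] have "blinfun_apply (B h) x \<le> primal_norm B h"
    by simp
  then show "blinfun_apply (c *\<^sub>R B h) x \<le> c * primal_norm B h"
    using assms by (simp add: B_simps mult_left_mono)
qed

lemma continuous_on_B_form: "continuous_on S (\<lambda>x. blinfun_apply (B (x - z)) (x - z))"
proof -
  have "bounded_linear B"
    using linear_B by (simp add: linear_linear)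
  then have "continuous_on S (\<lambda>x. B (x - z))"
    by (rule bounded_linear.continuous_on) (intro continuous_intros)
  then show ?thesis
    by (intro bounded_bilinear.continuous_on[OF bounded_bilinear_blinfun_apply] continuous_intros)
qed

text \<open>
  Compares the norm of \<open>B\<close> with the norm of the type class, so that compactness arguments apply.
\<close>

lemma B_coercive: "\<exists>c>0. \<forall>x. c * (norm x)\<^sup>2 \<le> blinfun_apply (B x) x"
proof -
  let ?S = "sphere (0::'a) 1"
  have "?S \<noteq> {}" "compact ?S"
    by auto
  then obtain u where u: "u \<in> ?S" "\<And>x. x \<in> ?S \<Longrightarrow> blinfun_apply (B u) u \<le> blinfun_apply (B x) x"
    using continuous_attains_inf[OF _ _ continuous_on_B_form[of ?S 0]] by auto
  have "blinfun_apply (B u) u * (norm x)\<^sup>2 \<le> blinfun_apply (B x) x" for x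
  proof (cases "x = 0")
    case False
    then have "blinfun_apply (B u) u \<le> blinfun_apply (B (x /\<^sub>R norm x)) (x /\<^sub>R norm x)"
      by (intro u(2)) simp
    then show ?thesis
      using False by (simp add: B_simps field_simps power2_eq_square)
  qed (simp add: B_simps)
  moreover have "u \<noteq> 0"
    using u(1) by auto
  ultimately show ?thesis
    using B_pos by blast
qed

section \<open>The gradient step\<close>

text \<open>
  The quadratic term dominates the linear one outside a ball around \<open>z\<close>, so it suffices to minimize
  over the compact set that this ball cuts out of \<open>Q\<close>.
\<close>

lemma prox_minimizer_exists:
  fixes l :: "'a \<Rightarrow>\<^sub>L real"
  assumes "closed Q" "z \<in> Q" "M > 0"
  shows "\<exists>t\<in>Q. \<forall>x\<in>Q. c + blinfun_apply l (t - z) + 1 / 2 * M * (primal_norm B (t - z))\<^sup>2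
                     \<le> c + blinfun_apply l (x - z) + 1 / 2 * M * (primal_norm B (x - z))\<^sup>2"
proof -
  define g where "g x = c + blinfun_apply l (x - z) + 1 / 2 * M * (primal_norm B (x - z))\<^sup>2" for x
  obtain e where e: "e > 0" "\<And>x. e * (norm x)\<^sup>2 \<le> blinfun_apply (B x) x"
    using B_coercive by blast
  define R where "R = 2 * norm l / (M * e)"
  have far: "g z \<le> g x" if "norm (x - z) > R" for x
  proof -
    have "norm (x - z) * (2 * norm l) \<le> norm (x - z) * (M * e * norm (x - z))"
      using that assms e by (intro mult_left_mono) (auto simp: R_def field_simps)
    moreover have "M * (e * (norm (x - z))\<^sup>2) \<le> M * (primal_norm B (x - z))\<^sup>2"
      using e(2)[of "x - z"] assms by (intro mult_left_mono) (auto simp: primal_norm_square)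
    moreover have "- blinfun_apply l (x - z) \<le> norm l * norm (x - z)"
      using norm_blinfun[of l "x - z"] by simp
    ultimately have "0 \<le> blinfun_apply l (x - z) + 1 / 2 * M * (primal_norm B (x - z))\<^sup>2"
      by (simp add: power2_eq_square algebra_simps)
    then show ?thesis
      by (simp add: g_def primal_norm_square B_simps)
  qed
  have "continuous_on (Q \<inter> cball z R) g"
    unfolding g_def primal_norm_square
    by (intro continuous_intros continuous_on_B_form)
  moreover have "R \<ge> 0"
    using assms e by (simp add: R_def)
  moreover have "compact (Q \<inter> cball z R)"
    using assms by (intro closed_Int_compact) auto
  ultimately obtain t where t: "t \<in> Q \<inter> cball z R" "\<And>x. x \<in> Q \<inter> cball z R \<Longrightarrow> g t \<le> g x"
    using continuous_attains_inf[of "Q \<inter> cball z R" g] assms(2) by fastforce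
  have "g t \<le> g x" if "x \<in> Q" for x
  proof (cases "norm (x - z) \<le> R")
    case True
    with that t show ?thesis by (simp add: dist_norm norm_minus_commute)
  next
    case False
    with far[of x] t(2)[of z] assms(2) \<open>R \<ge> 0\<close> show ?thesis by simp
  qed
  with t(1) show ?thesis
    unfolding g_def by blast
qed

lemma
  assumes "closed Q" "z \<in> Q" "M > 0"
  shows grad_step_mem: "grad_step B Q f df M z \<in> Q"
    and grad_step_minimal: "x \<in> Q \<Longrightarrow>
      blinfun_apply (df z) (grad_step B Q f df M z - z)
        + 1 / 2 * M * (primal_norm B (grad_step B Q f df M z - z))\<^sup>2
      \<le> blinfun_apply (df z) (x - z) + 1 / 2 * M * (primal_norm B (x - z))\<^sup>2"
proof -
  define g where
    "g = (\<lambda>x. f z + blinfun_apply (df z) (x - z) + 1 / 2 * M * (primal_norm B (x - z))\<^sup>2)"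
  obtain t where "is_arg_min g (\<lambda>x. x \<in> Q) t"
    using prox_minimizer_exists[OF assms, of "f z" "df z"]
    by (fastforce simp: g_def is_arg_min_linorder)
  then have "is_arg_min g (\<lambda>x. x \<in> Q) (grad_step B Q f df M z)"
    unfolding grad_step_def arg_min_on_def arg_min_def g_def[symmetric] by (rule someI)
  then show "grad_step B Q f df M z \<in> Q" and "x \<in> Q \<Longrightarrow>
      blinfun_apply (df z) (grad_step B Q f df M z - z)
        + 1 / 2 * M * (primal_norm B (grad_step B Q f df M z - z))\<^sup>2
      \<le> blinfun_apply (df z) (x - z) + 1 / 2 * M * (primal_norm B (x - z))\<^sup>2"
    by (auto simp: is_arg_min_linorder g_def)
qed

text \<open>
  The variational inequality of the minimizer \<open>T\<close>, tested in the direction of \<open>z\<close>: compare \<open>T\<close> with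
  \<open>(1 - a) T + a z\<close>, divide by \<open>a\<close> and let \<open>a\<close> tend to \<open>0\<close>.
\<close>

lemma grad_step_descent_direction:
  assumes "closed Q" "convex Q" "z \<in> Q" "M > 0"
  shows "blinfun_apply (df z) (grad_step B Q f df M z - z)
           \<le> - (M * (primal_norm B (grad_step B Q f df M z - z))\<^sup>2)"
proof -
  define T where "T = grad_step B Q f df M z"
  define p q where "p = blinfun_apply (df z) (T - z)" and "q = (primal_norm B (T - z))\<^sup>2"
  have "p + M * q \<le> a * (1 / 2 * M * q)" if a: "0 < a" "a < 1" for a
  proof -
    have "(1 - a) *\<^sub>R T + a *\<^sub>R z \<in> Q"
      using grad_step_mem[OF assms(1,3,4), of f df] assms a
      by (intro convexD) (auto simp: T_def)
    moreover have "(1 - a) *\<^sub>R T + a *\<^sub>R z - z = (1 - a) *\<^sub>R (T - z)"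
      by (simp add: algebra_simps)
    ultimately have "p + 1 / 2 * M * q \<le> (1 - a) * p + 1 / 2 * M * ((1 - a)\<^sup>2 * q)"
      using grad_step_minimal[OF assms(1,3,4), of "(1 - a) *\<^sub>R T + a *\<^sub>R z" df f]
      by (simp add: p_def q_def T_def primal_norm_scaleR B_simps power_mult_distrib)
    then have "a * (p + M * q) \<le> a * (a * (1 / 2 * M * q))"
      by (simp add: power2_eq_square algebra_simps)
    with a show ?thesis by simp
  qed
  then have "eventually (\<lambda>a. p + M * q \<le> a * (1 / 2 * M * q)) (at_right 0)"
    unfolding eventually_at_right_field by (intro exI[of _ 1] conjI zero_less_one) blast
  moreover have "((\<lambda>a. a * (1 / 2 * M * q)) \<longlongrightarrow> 0 * (1 / 2 * M * q)) (at_right 0)"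
    by (intro tendsto_intros)
  ultimately have "p + M * q \<le> 0"
    using tendsto_lowerbound[of "\<lambda>a. a * (1 / 2 * M * q)" 0 "at_right (0::real)"] by simp
  then show ?thesis
    by (simp add: p_def q_def T_def)
qed

end

section \<open>Moduli of subquadratic growth\<close>

lemma linear_has_integral:
  assumes "a \<le> b"
  shows "((\<lambda>t. c * t) has_integral c * ((b\<^sup>2 - a\<^sup>2) / 2)) {a..b::real}"
  using has_integral_mult_right[OF ident_has_integral[OF assms], of c] by simp

text \<open>
  The properties of the curvature bound that make its integral against \<open>d\<tau>/\<tau>\<close> usable. The growth
  condition at \<open>0\<close> is a weak form of the limit in the regularity assumption; it makes the
  integrand bounded.
\<close>

locale subquadratic_modulus =
  fixes G :: "real set" and m :: "real \<Rightarrow> real"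
  assumes G_nonneg: "t \<in> G \<Longrightarrow> 0 \<le> t"
    and G_down: "t \<in> G \<Longrightarrow> 0 \<le> s \<Longrightarrow> s \<le> t \<Longrightarrow> s \<in> G"
    and mono: "t \<in> G \<Longrightarrow> 0 \<le> s \<Longrightarrow> s \<le> t \<Longrightarrow> m s \<le> m t"
    and subquadratic: "t \<in> G \<Longrightarrow> 0 < s \<Longrightarrow> s \<le> t \<Longrightarrow> m t * s\<^sup>2 \<le> m s * t\<^sup>2"
    and pos: "t \<in> G \<Longrightarrow> 0 < t \<Longrightarrow> 0 < m t"
    and linear_near_0: "\<exists>d>0. \<forall>t. 0 < t \<and> t < d \<longrightarrow> m t \<le> t"
begin

definition sig :: "real \<Rightarrow> real" where
  "sig r = integral {0..r} (\<lambda>t. m t / t)"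

lemma quotient_integrable:
  assumes "r \<in> G"
  shows "(\<lambda>t. m t / t) integrable_on {0..r}"
proof -
  obtain d where d: "d > 0" "\<And>t. 0 < t \<Longrightarrow> t < d \<Longrightarrow> m t \<le> t"
    using linear_near_0 by blast
  have "m t \<le> (1 + \<bar>m r\<bar> / d) * t" if t: "0 < t" "t \<le> r" for t
  proof (cases "t < d")
    case True
    have "0 \<le> \<bar>m r\<bar> / d * t"
      using d t by simp
    with d(2)[OF t(1) True] show ?thesis
      by (simp add: algebra_simps)
  next
    case False
    have "m t \<le> \<bar>m r\<bar>"
      using mono[OF assms, of t] t by simp
    also have "\<dots> \<le> \<bar>m r\<bar> / d * t"
      using False d mult_left_mono[of d t "\<bar>m r\<bar>"] by (simp add: field_simps)
    finally show ?thesis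
      using t by (simp add: algebra_simps)
  qed
  moreover have "0 \<le> m t" if "0 < t" "t \<le> r" for t
    using pos[of t] that G_down[OF assms, of t] by simp
  ultimately have bound: "norm (m t / t) \<le> 1 + \<bar>m r\<bar> / d" if "t \<in> {0..r}" for t
    using that d by (cases "t = 0") (auto simp: divide_simps)
  have "mono_on {0..r} m"
    using mono G_down[OF assms] by (auto simp: mono_on_def)
  then have "m \<in> borel_measurable (lebesgue_on {0..r})"
    by (intro borel_measurable_integrable integrable_mono_on)
  moreover have "(\<lambda>t. t) \<in> borel_measurable (lebesgue_on {0..r})"
    by (intro continuous_imp_measurable_on_sets_lebesgue continuous_intros) auto
  ultimately have "(\<lambda>t. m t / t) \<in> borel_measurable (lebesgue_on {0..r})"
    by (rule borel_measurable_divide)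
  then show ?thesis
    by (rule measurable_bounded_by_integrable_imp_integrable[where g = "\<lambda>_. 1 + \<bar>m r\<bar> / d"])
      (use bound in auto)
qed

lemma sig_diff:
  assumes "0 \<le> a" "a \<le> b" "b \<in> G"
  shows "((\<lambda>t. m t / t) has_integral (sig b - sig a)) {a..b}"
proof -
  have "(\<lambda>t. m t / t) integrable_on {0..b}"
    by (rule quotient_integrable[OF assms(3)])
  moreover from this have "(\<lambda>t. m t / t) integrable_on {a..b}"
    by (rule integrable_subinterval_real) (use assms in auto)
  ultimately show ?thesis
    using Henstock_Kurzweil_Integration.integral_combine[OF assms(1,2), of "\<lambda>t. m t / t"]
    by (auto simp: sig_def has_integral_iff)
qed

text \<open>
  On \<open>[a, b]\<close> the integrand \<open>m(t)/t = t \<cdot> m(t)/t\<^sup>2\<close> lies between the linear functions with slopes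
  \<open>m(b)/b\<^sup>2\<close> and \<open>m(a)/a\<^sup>2\<close>. The two resulting bounds on increments of the integral give
  all its properties below, monotonicity of \<open>sig(r)/r\<^sup>2\<close> included, without a change of variables.
\<close>

lemma sig_diff_lower:
  assumes "0 \<le> a" "a \<le> b" "0 < b" "b \<in> G"
  shows "m b / b\<^sup>2 * ((b\<^sup>2 - a\<^sup>2) / 2) \<le> sig b - sig a"
proof (rule has_integral_le[OF linear_has_integral[OF assms(2)] sig_diff[OF assms(1,2,4)]])
  fix t assume "t \<in> {a..b}"
  then show "m b / b\<^sup>2 * t \<le> m t / t"
    using subquadratic[OF assms(4), of t] assms
    by (cases "t = 0") (auto simp: field_simps power2_eq_square)
qed

lemma sig_diff_upper:
  assumes "0 < a" "a \<le> b" "b \<in> G"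
  shows "sig b - sig a \<le> m a / a\<^sup>2 * ((b\<^sup>2 - a\<^sup>2) / 2)"
proof (rule has_integral_le[OF sig_diff linear_has_integral[OF assms(2)]])
  fix t assume t: "t \<in> {a..b}"
  then show "m t / t \<le> m a / a\<^sup>2 * t"
    using subquadratic[of t a] G_down[OF assms(3), of t] assms
    by (auto simp: field_simps power2_eq_square)
qed (use assms in auto)

lemma sig_0: "sig 0 = 0"
  by (simp add: sig_def)

lemma modulus_le_sig:
  assumes "0 < r" "r \<in> G"
  shows "m r \<le> 2 * sig r"
  using sig_diff_lower[of 0 r] assms by (simp add: sig_0)

lemma sig_strict_mono:
  assumes "0 \<le> a" "a < b" "b \<in> G"
  shows "sig a < sig b"
proof -
  have "0 < m b / b\<^sup>2 * ((b\<^sup>2 - a\<^sup>2) / 2)"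
    using assms pos[of b] by (simp add: power_strict_mono)
  with sig_diff_lower[of a b] assms show ?thesis
    by simp
qed

lemma sig_mono: "0 \<le> a \<Longrightarrow> a \<le> b \<Longrightarrow> b \<in> G \<Longrightarrow> sig a \<le> sig b"
  using sig_strict_mono[of a b] by (cases "a = b") auto

lemma inj_on_sig: "inj_on sig G"
  using sig_strict_mono G_nonneg by (intro linorder_inj_onI') force

lemma sig_subquadratic:
  assumes "0 < a" "a \<le> b" "b \<in> G"
  shows "sig b * a\<^sup>2 \<le> sig a * b\<^sup>2"
proof -
  have "m a \<le> 2 * sig a"
    using modulus_le_sig G_down[OF assms(3), of a] assms by simp
  then have "m a * (b\<^sup>2 - a\<^sup>2) \<le> 2 * sig a * (b\<^sup>2 - a\<^sup>2)"
    using assms by (intro mult_right_mono) (auto simp: power_mono)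
  moreover have "(sig b - sig a) * a\<^sup>2 \<le> m a * (b\<^sup>2 - a\<^sup>2) / 2"
    using sig_diff_upper[OF assms] assms by (simp add: field_simps)
  ultimately show ?thesis
    by (simp add: algebra_simps)
qed

end

section \<open>The global curvature bound\<close>

text \<open>
  Two quantities that bound each other with factor \<open>q < 1\<close> are both at most the fixed point \<open>d\<close>.
\<close>

lemma coupled_bound:
  fixes u v q d :: real
  assumes "u \<le> q * v + (1 - q) * d" "v \<le> q * u + (1 - q) * d" "0 \<le> q" "q < 1"
  shows "u \<le> d"
proof -
  have "(1 - q) * max u v \<le> (1 - q) * d"
    using assms mult_left_mono[of u v q] mult_left_mono[of v u q]
    by (cases "u \<le> v") (auto simp: algebra_simps max_def)
  with assms(4) show ?thesis by simp
qed

locale curvature_bound = pd_operator B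
  for B :: "'a::euclidean_space \<Rightarrow> 'a \<Rightarrow>\<^sub>L real" +
  fixes D :: "'a set" and f :: "'a \<Rightarrow> real" and df :: "'a \<Rightarrow> 'a \<Rightarrow>\<^sub>L real"
  assumes convex_D: "convex D"
    and not_affine: "\<not> affine_fun_on D f"
    and has_gradient: "x \<in> D \<Longrightarrow> (f has_derivative blinfun_apply (df x)) (at x within D)"
    and regular: "regularity_assumption B D f"
begin

abbreviation "\<Gamma> \<equiv> Gamma_set B D"
abbreviation "\<mu> t \<equiv> real_of_ereal (mu_hat B D f t)"
abbreviation "\<sigma> \<equiv> sigma_hat B D f"

lemma D_nonempty: "D \<noteq> {}"
  using not_affine by (auto simp: affine_fun_on_def)

lemma distance_in_Gamma:
  assumes "x \<in> D" "y \<in> D"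
  shows "primal_norm B (x - y) \<in> \<Gamma>"
proof -
  have "ereal (primal_norm B (x - y)) \<le> diam B D"
    unfolding diam_def using assms by (intro SUP_upper2[of "(x, y)"]) auto
  then show ?thesis
    by (simp add: Gamma_set_def primal_norm_nonneg)
qed

lemma Gamma_nonneg: "t \<in> \<Gamma> \<Longrightarrow> 0 \<le> t"
  by (simp add: Gamma_set_def)

lemma Gamma_down: "t \<in> \<Gamma> \<Longrightarrow> 0 \<le> s \<Longrightarrow> s \<le> t \<Longrightarrow> s \<in> \<Gamma>"
  by (auto simp: Gamma_set_def elim: order_trans[rotated])

lemma mu_hat_real:
  assumes "t \<in> \<Gamma>"
  obtains c where "mu_hat B D f t = ereal c" "\<mu> t = c"
  using regular assms unfolding regularity_assumption_def
  by (cases "mu_hat B D f t") auto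

lemma mu_bounds_gap:
  assumes "t \<in> \<Gamma>" "x \<in> D" "y \<in> D" "primal_norm B (x - y) \<le> t" "0 < a" "a < 1"
  shows "\<bar>a * f x + (1 - a) * f y - f (a *\<^sub>R x + (1 - a) *\<^sub>R y)\<bar> \<le> a * (1 - a) * \<mu> t"
proof -
  have "ereal (\<bar>a * f x + (1 - a) * f y - f (a *\<^sub>R x + (1 - a) *\<^sub>R y)\<bar> / (a * (1 - a)))
          \<le> mu_hat B D f t"
    unfolding mu_hat_def using assms by (intro SUP_upper2[of "(x, y, a)"]) auto
  then show ?thesis
    using assms(5,6) by (cases rule: mu_hat_real[OF assms(1)]) (simp add: field_simps)
qed

lemma mu_least:
  assumes "t \<in> \<Gamma>"
    and "\<And>x y a. x \<in> D \<Longrightarrow> y \<in> D \<Longrightarrow> primal_norm B (x - y) \<le> t \<Longrightarrow> 0 < a \<Longrightarrow> a < 1 \<Longrightarrow>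
      \<bar>a * f x + (1 - a) * f y - f (a *\<^sub>R x + (1 - a) *\<^sub>R y)\<bar> \<le> a * (1 - a) * c"
  shows "\<mu> t \<le> c"
proof -
  have "mu_hat B D f t \<le> ereal c"
    unfolding mu_hat_def
  proof (rule SUP_least, clarify)
    fix x y a
    assume "x \<in> D" "y \<in> D" "0 < a" "a < (1::real)" "primal_norm B (x - y) \<le> t"
    with assms(2)[of x y a]
    show "ereal (\<bar>a * f x + (1 - a) * f y - f (a *\<^sub>R x + (1 - a) *\<^sub>R y)\<bar> / (a * (1 - a))) \<le> ereal c"
      by (simp add: field_simps)
  qed
  then show ?thesis
    by (cases rule: mu_hat_real[OF assms(1)]) simp
qed

lemma mu_mono:
  assumes "t \<in> \<Gamma>" "0 \<le> s" "s \<le> t"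
  shows "\<mu> s \<le> \<mu> t"
  using Gamma_down[OF assms] assms by (intro mu_least mu_bounds_gap) auto

lemma mu_nonneg:
  assumes "t \<in> \<Gamma>"
  shows "0 \<le> \<mu> t"
proof -
  obtain x where "x \<in> D"
    using D_nonempty by blast
  then show ?thesis
    using mu_bounds_gap[OF assms, of x x "1 / 2"] Gamma_nonneg[OF assms]
    by (simp add: primal_norm_def B_simps scaleR_left_distrib[symmetric])
qed

text \<open>
  Parametrize the segment by \<open>[0, 1]\<close> and let \<open>A\<close> be the interpolation error relative to its
  endpoints. The subsegments \<open>[0, b]\<close> and \<open>[1 - b, 1]\<close> have length at most \<open>b t\<close>, so on them \<open>A\<close>
  deviates from its own chord by at most \<open>l (1 - l) \<mu>(b t)\<close>. As \<open>b > 1/2\<close>, each of the points \<open>b\<close> and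
  \<open>1 - b\<close> lies inside the other subsegment; this bounds \<open>A(b)\<close> and \<open>A(1 - b)\<close> by each other, hence
  absolutely. The two subsegments cover \<open>[0, 1]\<close>, and the deviation from the chord plus the value of
  the chord adds up to exactly \<open>a (1 - a) \<mu>(b t)/b\<^sup>2\<close>.
\<close>

lemma mu_scale_half:
  assumes "t \<in> \<Gamma>" "1 / 2 < b" "b < 1"
  shows "\<mu> t \<le> \<mu> (b * t) / b\<^sup>2"
proof (rule mu_least[OF assms(1)])
  fix x y and a :: real
  assume x: "x \<in> D" and y: "y \<in> D" and xy: "primal_norm B (x - y) \<le> t" and a: "0 < a" "a < 1"
  define c where "c = \<mu> (b * t)"
  define P where "P s = y + s *\<^sub>R (x - y)" for s :: real
  define A where "A s = s * f x + (1 - s) * f y - f (P s)" for s :: real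
  have PD: "P s \<in> D" if "0 \<le> s" "s \<le> 1" for s
  proof -
    have "P s = s *\<^sub>R x + (1 - s) *\<^sub>R y"
      by (simp add: P_def algebra_simps)
    with that x y convexD[OF convex_D, of x y s "1 - s"] show ?thesis by simp
  qed
  have "0 \<le> b * t" "b * t \<le> t"
    using assms Gamma_nonneg[OF assms(1)] by (auto simp: mult_left_le_one_le)
  then have bt: "b * t \<in> \<Gamma>"
    using Gamma_down[OF assms(1)] by blast
  have sub: "\<bar>A ((1 - l) * u + l * v) - ((1 - l) * A u + l * A v)\<bar> \<le> l * (1 - l) * c"
    if uv: "0 \<le> u" "u \<le> 1" "0 \<le> v" "v \<le> 1" "\<bar>v - u\<bar> = b" and l: "0 < l" "l \<le> 1" for u v l
  proof (cases "l = 1")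
    case False
    have "P v - P u = (v - u) *\<^sub>R (x - y)"
      by (simp add: P_def algebra_simps)
    then have "primal_norm B (P v - P u) \<le> b * t"
      using uv xy assms by (simp add: primal_norm_scaleR)
    then have "\<bar>l * f (P v) + (1 - l) * f (P u) - f (l *\<^sub>R P v + (1 - l) *\<^sub>R P u)\<bar> \<le> l * (1 - l) * c"
      unfolding c_def using uv l False by (intro mu_bounds_gap bt PD) auto
    moreover have "l *\<^sub>R P v + (1 - l) *\<^sub>R P u = P ((1 - l) * u + l * v)"
      by (simp add: P_def algebra_simps)
    moreover have "A w - ((1 - l) * A u + l * A v) = l * f (P v) + (1 - l) * f (P u) - f (P w)"
      if "w = (1 - l) * u + l * v" for w
      unfolding A_def that by (simp add: algebra_simps)
    ultimately show ?thesis by simp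
  qed simp
  have A01: "A 0 = 0" "A 1 = 0"
    by (simp_all add: A_def P_def)
  \<comment> \<open>\<open>q\<close> is the local coordinate of \<open>b\<close> in the segment from \<open>1\<close> to \<open>1 - b\<close>, and of \<open>1 - b\<close> in the
     segment from \<open>0\<close> to \<open>b\<close>\<close>
  define q where "q = (1 - b) / b"
  have q: "0 < q" "q < 1" "b * q = 1 - b"
    using assms by (auto simp: q_def field_simps)
  have "1 - q * b = b"
    using q by (simp add: algebra_simps)
  then have "\<bar>A b - q * A (1 - b)\<bar> \<le> q * (1 - q) * c" "\<bar>A (1 - b) - q * A b\<bar> \<le> q * (1 - q) * c"
    using sub[of 1 "1 - b" q] sub[of 0 b q] q A01 assms by (simp_all add: algebra_simps)
  moreover have "0 \<le> q * \<bar>A (1 - b)\<bar>" "0 \<le> q * \<bar>A b\<bar>"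
    using q by auto
  ultimately have "\<bar>A b\<bar> \<le> q * \<bar>A (1 - b)\<bar> + q * (1 - q) * c"
      "\<bar>A (1 - b)\<bar> \<le> q * \<bar>A b\<bar> + q * (1 - q) * c"
    using abs_triangle_ineq[of "A b - q * A (1 - b)" "q * A (1 - b)"]
      abs_triangle_ineq[of "A (1 - b) - q * A b" "q * A b"] q by (auto simp: abs_mult)
  then have "\<bar>A b\<bar> \<le> q * \<bar>A (1 - b)\<bar> + (1 - q) * (q * c)"
      "\<bar>A (1 - b)\<bar> \<le> q * \<bar>A b\<bar> + (1 - q) * (q * c)"
    by (simp_all only: mult.assoc mult.commute mult.left_commute)
  then have Ab: "\<bar>A b\<bar> \<le> q * c" and Ab': "\<bar>A (1 - b)\<bar> \<le> q * c"
    using coupled_bound[of "\<bar>A b\<bar>" q "\<bar>A (1 - b)\<bar>" "q * c"]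
      coupled_bound[of "\<bar>A (1 - b)\<bar>" q "\<bar>A b\<bar>" "q * c"] q by auto
  have combine: "\<bar>A a\<bar> \<le> l * b * (1 - l * b) * (c / b\<^sup>2)"
    if "\<bar>A a - l * z\<bar> \<le> l * (1 - l) * c" "\<bar>z\<bar> \<le> q * c" "0 < l" for l z
  proof -
    have "\<bar>l * z\<bar> \<le> l * (q * c)"
      using that by (simp add: abs_mult)
    with that(1) have "\<bar>A a\<bar> \<le> l * (1 - l) * c + l * (q * c)"
      by linarith
    also have "\<dots> = l * b * (1 - l * b) * (c / b\<^sup>2)"
      using assms by (simp add: q_def field_simps power2_eq_square)
    finally show ?thesis .
  qed
  have "\<bar>A a\<bar> \<le> a * (1 - a) * (c / b\<^sup>2)"
  proof (cases "a \<le> b")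
    case True
    then have "\<bar>A a - a / b * A b\<bar> \<le> a / b * (1 - a / b) * c"
      using sub[of 0 b "a / b"] assms a A01 by simp
    from combine[OF this Ab] show ?thesis
      using assms a by simp
  next
    case False
    define l where "l = (1 - a) / b"
    have l: "0 < l" "l \<le> 1" "l * b = 1 - a"
      using False a assms by (auto simp: l_def field_simps)
    have "(1 - l) * 1 + l * (1 - b) = a"
      using l by (simp add: algebra_simps)
    then have "\<bar>A a - l * A (1 - b)\<bar> \<le> l * (1 - l) * c"
      using sub[of 1 "1 - b" l] assms l A01 by simp
    from combine[OF this Ab' l(1)] show ?thesis
      using l(3) by (simp add: mult.commute)
  qed
  moreover have "A a = a * f x + (1 - a) * f y - f (a *\<^sub>R x + (1 - a) *\<^sub>R y)"
    by (simp add: A_def P_def algebra_simps)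
  ultimately show "\<bar>a * f x + (1 - a) * f y - f (a *\<^sub>R x + (1 - a) *\<^sub>R y)\<bar>
      \<le> a * (1 - a) * (\<mu> (b * t) / b\<^sup>2)"
    by (simp add: c_def)
qed

text \<open>
  Any factor in \<open>(0, 1]\<close> is a product of factors in \<open>(1/2, 1]\<close>; the induction splits off \<open>2/3\<close>.
\<close>

lemma mu_scale:
  assumes "t \<in> \<Gamma>" "0 < b" "b \<le> 1"
  shows "\<mu> t \<le> \<mu> (b * t) / b\<^sup>2"
proof -
  have "\<mu> t \<le> \<mu> (b * t) / b\<^sup>2" if "(2 / 3) ^ n \<le> b" "b \<le> 1" for n b
    using that
  proof (induction n arbitrary: b)
    case (Suc n)
    show ?case
    proof (cases "b \<le> 2 / 3")
      case False
      with Suc.prems mu_scale_half[OF assms(1), of b] show ?thesis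
        by (cases "b = 1") auto
    next
      case True
      define c where "c = 3 / 2 * b"
      have c: "(2 / 3) ^ n \<le> c" "c \<le> 1" "0 < c"
        using Suc.prems True by (auto simp: c_def intro: less_le_trans[of _ "(2 / 3) ^ Suc n"])
      then have "c * t \<in> \<Gamma>"
        using Gamma_nonneg[OF assms(1)] by (intro Gamma_down[OF assms(1)]) (auto simp: mult_left_le_one_le)
      then have "\<mu> (c * t) \<le> \<mu> (b * t) / (2 / 3)\<^sup>2"
        using mu_scale_half[of "c * t" "2 / 3"] by (simp add: c_def)
      then have "\<mu> (c * t) / c\<^sup>2 \<le> \<mu> (b * t) / (2 / 3)\<^sup>2 / c\<^sup>2"
        by (rule divide_right_mono) simp
      also have "\<dots> = \<mu> (b * t) / b\<^sup>2"
        by (simp add: c_def power_mult_distrib power_divide)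
      finally show ?thesis
        using Suc.IH[OF c(1,2)] by simp
    qed
  qed simp
  moreover obtain n where "(2 / 3) ^ n < b"
    using real_arch_pow_inv[OF assms(2), of "2 / 3"] by auto
  ultimately show ?thesis
    using assms(3) by (blast intro: less_imp_le)
qed

lemma mu_subquadratic:
  assumes "t \<in> \<Gamma>" "0 < s" "s \<le> t"
  shows "\<mu> t * s\<^sup>2 \<le> \<mu> s * t\<^sup>2"
  using mu_scale[OF assms(1), of "s / t"] assms by (simp add: field_simps)

text \<open>
  With \<open>s\<close> the weight of \<open>y\<close>, the defining bound of \<open>\<mu>\<close> divided by \<open>s\<close> compares \<open>f y - f x\<close> with a
  difference quotient of \<open>f\<close> at \<open>x\<close>, up to \<open>(1 - s) \<mu> t\<close>; then \<open>s\<close> tends to \<open>0\<close>.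
\<close>

lemma linearization_error:
  assumes "x \<in> D" "y \<in> D" "t \<in> \<Gamma>" "primal_norm B (y - x) \<le> t"
  shows "\<bar>f y - f x - blinfun_apply (df x) (y - x)\<bar> \<le> \<mu> t"
proof -
  define P where "P s = x + s *\<^sub>R (y - x)" for s :: real
  have P: "P s = s *\<^sub>R y + (1 - s) *\<^sub>R x" for s
    by (simp add: P_def algebra_simps)
  have PD: "P ` {0..1} \<subseteq> D"
    using convexD[OF convex_D assms(2,1)] by (auto simp: P)
  have "(P has_vector_derivative (y - x)) (at 0 within {0..1})"
    unfolding P_def by (auto intro!: derivative_eq_intros)
  moreover have "(f has_derivative blinfun_apply (df x)) (at (P 0) within P ` {0..1})"
    using has_derivative_subset[OF has_gradient[OF assms(1)] PD] by (simp add: P_def)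
  ultimately have "((f \<circ> P) has_derivative (blinfun_apply (df x) \<circ> (\<lambda>s. s *\<^sub>R (y - x))))
      (at 0 within {0..1})"
    unfolding has_vector_derivative_def by (rule diff_chain_within)
  then have "((f \<circ> P) has_real_derivative blinfun_apply (df x) (y - x)) (at 0 within {0..1})"
    by (simp add: has_field_derivative_def o_def B_simps mult_commute_abs)
  then have "((\<lambda>s. (f (P s) - f x) / s) \<longlongrightarrow> blinfun_apply (df x) (y - x)) (at_right 0)"
    by (simp add: has_field_derivative_iff at_within_Icc_at_right P_def)
  then have lim: "((\<lambda>s. \<bar>f y - f x - (f (P s) - f x) / s\<bar>) \<longlongrightarrow> \<bar>f y - f x - blinfun_apply (df x) (y - x)\<bar>)
      (at_right 0)"
    by (intro tendsto_intros)
  have "\<bar>f y - f x - (f (P s) - f x) / s\<bar> \<le> \<mu> t" if s: "0 < s" "s < 1" for s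
  proof -
    have "f y - f x - (f (P s) - f x) / s = (s * f y + (1 - s) * f x - f (P s)) / s"
      using s by (simp add: field_simps)
    moreover have "\<bar>s * f y + (1 - s) * f x - f (P s)\<bar> \<le> s * (1 - s) * \<mu> t"
      unfolding P using assms s by (intro mu_bounds_gap)
    ultimately have "\<bar>f y - f x - (f (P s) - f x) / s\<bar> \<le> (1 - s) * \<mu> t"
      using s by (simp add: field_simps)
    also have "\<dots> \<le> \<mu> t"
      using s mu_nonneg[OF assms(3)] by (simp add: mult_left_le_one_le)
    finally show ?thesis .
  qed
  then have "eventually (\<lambda>s. \<bar>f y - f x - (f (P s) - f x) / s\<bar> \<le> \<mu> t) (at_right 0)"
    unfolding eventually_at_right_field by (intro exI[of _ 1] conjI zero_less_one) blast
  with lim show ?thesis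
    by (rule tendsto_upperbound) simp
qed

text \<open>
  A zero of \<open>\<mu>\<close> at some \<open>t > 0\<close> spreads to the left by monotonicity and to the right by
  subquadratic growth, and then \<open>f\<close> coincides with its linearization.
\<close>

lemma mu_pos:
  assumes "t \<in> \<Gamma>" "0 < t"
  shows "0 < \<mu> t"
proof (rule ccontr)
  assume "\<not> 0 < \<mu> t"
  then have le_0: "\<mu> t \<le> 0"
    by linarith
  have zero: "\<mu> r \<le> 0" if "r \<in> \<Gamma>" for r
  proof (cases "r \<le> t")
    case True
    then show ?thesis
      using mu_mono[OF assms(1) Gamma_nonneg[OF that]] le_0 by linarith
  next
    case False
    then have "\<mu> r * t\<^sup>2 \<le> \<mu> t * r\<^sup>2"
      using mu_subquadratic[OF that assms(2)] by simp
    also have "\<dots> \<le> 0"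
      using le_0 by (rule mult_nonpos_nonneg) simp
    finally show ?thesis
      using assms(2) by (metis mult_pos_pos not_le zero_less_power)
  qed
  obtain x where x: "x \<in> D"
    using D_nonempty by blast
  have "f y = blinfun_apply (df x) y + (f x - blinfun_apply (df x) x)" if "y \<in> D" for y
  proof -
    have "\<bar>f y - f x - blinfun_apply (df x) (y - x)\<bar> \<le> 0"
      using linearization_error[OF x that distance_in_Gamma[OF that x] order_refl]
        zero[OF distance_in_Gamma[OF that x]] by linarith
    then show ?thesis
      by (simp add: blinfun.diff_right)
  qed
  then have "affine_fun_on D f"
    unfolding affine_fun_on_def by (intro exI ballI)
  with not_affine show False ..
qed

lemma Gamma_contains_right_nbhd: "\<exists>d>0. d \<in> \<Gamma>"
proof -
  obtain x where x: "x \<in> D"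
    using D_nonempty by blast
  have "\<not> D \<subseteq> {x}"
  proof
    assume "D \<subseteq> {x}"
    then have "y = x" if "y \<in> D" for y
      using that by blast
    then have "f y = blinfun_apply 0 y + f x" if "y \<in> D" for y
      using that by simp
    then have "affine_fun_on D f"
      unfolding affine_fun_on_def by (intro exI ballI)
    with not_affine show False ..
  qed
  then obtain y where y: "y \<in> D" "y \<noteq> x"
    by blast
  then have "primal_norm B (y - x) > 0"
    by (simp add: primal_norm_def B_pos)
  with distance_in_Gamma[OF y(1) x] show ?thesis
    by (intro exI[of _ "primal_norm B (y - x)"] conjI)
qed

lemma mu_le_id_near_0: "\<exists>d>0. \<forall>t. 0 < t \<and> t < d \<longrightarrow> \<mu> t \<le> t"
proof -
  obtain e where e: "e > 0" "e \<in> \<Gamma>"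
    using Gamma_contains_right_nbhd by blast
  have "((\<lambda>t. mu_hat B D f t / ereal t) \<longlongrightarrow> 0) (at_right 0)"
    using regular by (simp add: regularity_assumption_def)
  then have "eventually (\<lambda>t. mu_hat B D f t / ereal t < 1) (at_right 0)"
    by (rule order_tendstoD) simp
  then obtain d where d: "d > 0" "\<And>t. 0 < t \<Longrightarrow> t < d \<Longrightarrow> mu_hat B D f t / ereal t < 1"
    unfolding eventually_at_right_field by blast
  have "\<mu> t \<le> t" if "0 < t" "t < min d e" for t
  proof -
    have "t \<in> \<Gamma>"
      using that e by (auto intro!: Gamma_down[OF e(2)])
    then show ?thesis
      using d(2)[of t] that by (cases rule: mu_hat_real) (simp add: field_simps)
  qed
  with d(1) e(1) show ?thesis
    by (intro exI[of _ "min d e"]) auto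
qed

sublocale subquadratic_modulus \<Gamma> \<mu>
  by unfold_locales
    (fact Gamma_nonneg Gamma_down mu_mono mu_subquadratic mu_pos mu_le_id_near_0)+

lemma sigma_hat_eq_sig: "\<sigma> = sig"
  by (simp add: fun_eq_iff sigma_hat_def sig_def)

lemma upper_model:
  assumes "x \<in> D" "y \<in> D"
  shows "f y \<le> f x + blinfun_apply (df x) (y - x) + 2 * sig (primal_norm B (y - x))"
proof (cases "y = x")
  case True
  then show ?thesis by (simp add: primal_norm_def B_simps sig_0)
next
  case False
  then have "primal_norm B (y - x) > 0"
    by (simp add: primal_norm_def B_pos)
  then show ?thesis
    using modulus_le_sig[OF _ distance_in_Gamma[OF assms(2,1)]]
      linearization_error[OF assms distance_in_Gamma[OF assms(2,1)] order_refl] by simp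
qed

lemma gamma_hat_sig:
  assumes "r \<in> \<Gamma>"
  shows "gamma_hat B D f (2 * sig r) = 4 * sig r / r\<^sup>2"
  using assms the_inv_into_f_f[OF inj_on_sig assms]
  by (simp add: gamma_hat_def s_hat_def sigma_hat_eq_sig)

lemma gamma_hat_antimono:
  assumes "0 < s" "s \<le> t" "s \<in> gamma_dom B D f" "t \<in> gamma_dom B D f"
  shows "gamma_hat B D f t \<le> gamma_hat B D f s"
proof -
  obtain a b where ab: "a \<in> \<Gamma>" "b \<in> \<Gamma>" "s = 2 * sig a" "t = 2 * sig b"
    using assms(3,4) by (auto simp: gamma_dom_def sigma_hat_eq_sig)
  have "a \<le> b"
    using sig_strict_mono[of b a] ab assms(2) Gamma_nonneg[of b] by (force simp: not_less[symmetric])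
  moreover have "0 < a"
    using ab assms(1) Gamma_nonneg[of a] sig_0 by (cases "a = 0") auto
  ultimately show ?thesis
    using sig_subquadratic[of a b] ab by (simp add: gamma_hat_sig field_simps)
qed

end

section \<open>Analysis of the method\<close>

text \<open>
  Here \<open>\<rho>\<close> is the radius with \<open>sig \<rho> = \<Delta>\<^sub>0/N\<close>; the last assumption is the
  hypothesis on \<open>N\<close>, read through the strict monotonicity of \<open>sig\<close>.
\<close>

locale ggm_analysis = curvature_bound B D f df
  for B :: "'a::euclidean_space \<Rightarrow> 'a \<Rightarrow>\<^sub>L real" and D f df +
  fixes Q :: "'a set" and \<delta> \<rho> :: real
  assumes closed_Q: "closed Q" and convex_Q: "convex Q" and Q_subset: "Q \<subseteq> D"
    and \<delta>_pos: "\<delta> > 0"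
    and \<rho>_Gamma: "\<rho> \<in> \<Gamma>" and \<rho>_pos: "\<rho> > 0"
    and \<delta>_large: "32 * (sig \<rho>)\<^sup>2 < \<delta>\<^sup>2 * \<rho>\<^sup>2"
begin

abbreviation "step M x \<equiv> grad_step B Q f df M x"

text \<open>
  \<open>E\<close> is the guaranteed decrease per iteration, and \<open>\<gamma>\<close> is \<open>gamma_hat\<close> at \<open>2 E\<close>.
\<close>

definition "E = sig \<rho>"
definition "\<gamma> = 4 * E / \<rho>\<^sup>2"

lemma E_pos: "E > 0"
  using sig_strict_mono[of 0 \<rho>] \<rho>_pos \<rho>_Gamma by (simp add: E_def sig_0)

lemma \<gamma>_pos: "\<gamma> > 0"
  using E_pos \<rho>_pos by (simp add: \<gamma>_def)

lemma \<delta>_square: "8 * E * \<gamma> < \<delta>\<^sup>2"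
  using \<delta>_large \<rho>_pos by (simp add: \<gamma>_def E_def field_simps power2_eq_square)

lemma not_stop_step_length:
  assumes "M > 0" "\<not> ggm_stop B Q f df \<delta> x M i"
  shows "\<delta> < 2 ^ i * M * primal_norm B (step (2 ^ i * M) x - x)"
  using assms dual_norm_B_le[of "2 ^ i * M" "x - step (2 ^ i * M) x"]
  by (simp add: ggm_stop_def primal_norm_commute[of x])

text \<open>
  Multiplying \<open>L r > \<delta>\<close> with itself and using \<open>L \<le> 2 \<gamma>\<close> once. This one inequality serves both
  purposes: it absorbs the model error of short steps, and it quantifies the decrease of accepted ones.
\<close>

lemma long_step:
  assumes "M > 0" "\<not> ggm_stop B Q f df \<delta> x M i" "2 ^ i * M \<le> 2 * \<gamma>"
  shows "4 * E < 2 ^ i * M * (primal_norm B (step (2 ^ i * M) x - x))\<^sup>2"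
proof -
  define L where "L = 2 ^ i * M"
  define r where "r = primal_norm B (step L x - x)"
  have "\<delta> < L * r"
    unfolding L_def r_def by (rule not_stop_step_length[OF assms(1,2)])
  then have "\<delta>\<^sup>2 < (L * r)\<^sup>2"
    using \<delta>_pos by (intro power_strict_mono) auto
  also have "\<dots> = L * (L * r\<^sup>2)"
    by (simp add: power2_eq_square algebra_simps)
  also have "\<dots> \<le> 2 * \<gamma> * (L * r\<^sup>2)"
    using assms by (intro mult_right_mono) (auto simp: L_def)
  finally have "2 * \<gamma> * (4 * E) < 2 * \<gamma> * (L * r\<^sup>2)"
    using \<delta>_square by (simp add: algebra_simps)
  then have "4 * E < L * r\<^sup>2"
    using \<gamma>_pos by simp
  then show ?thesis
    unfolding L_def r_def .
qed

lemma ggm_accept_iff: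
  "ggm_accept B Q f df x M i \<longleftrightarrow>
     2 ^ i * M / 4 * (primal_norm B (step (2 ^ i * M) x - x))\<^sup>2 \<le> f x - f (step (2 ^ i * M) x)"
  by (simp add: ggm_accept_def power_int_diff)

text \<open>
  Acceptance follows once the error \<open>2 sig r\<close> of the upper model is at most half of \<open>L r\<^sup>2\<close>. For
  \<open>r \<ge> \<rho>\<close> this is the monotonicity of \<open>sig r / r\<^sup>2\<close>. For \<open>r < \<rho>\<close> that ratio may be arbitrarily large,
  but then \<open>sig r \<le> E\<close>, and \<open>L \<le> 2 \<gamma>\<close> forces \<open>L r\<^sup>2 > 4 E\<close>.
\<close>

lemma trial_accepted:
  assumes "x \<in> Q" "M > 0" "\<not> ggm_stop B Q f df \<delta> x M i"
    and "\<gamma> < 2 ^ i * M" "2 ^ i * M \<le> 2 * \<gamma>"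
  shows "ggm_accept B Q f df x M i"
proof -
  define L where "L = 2 ^ i * M"
  define r where "r = primal_norm B (step L x - x)"
  have L: "L > 0" "\<gamma> < L" "L \<le> 2 * \<gamma>"
    using assms by (simp_all add: L_def)
  have mem: "step L x \<in> Q"
    using grad_step_mem[OF closed_Q assms(1) L(1)] .
  have descent: "blinfun_apply (df x) (step L x - x) \<le> - (L * r\<^sup>2)"
    unfolding r_def by (rule grad_step_descent_direction[OF closed_Q convex_Q assms(1) L(1)])
  have model: "f (step L x) \<le> f x + blinfun_apply (df x) (step L x - x) + 2 * sig r"
    unfolding r_def using mem assms(1) Q_subset by (intro upper_model) auto
  have "\<delta> < L * r"
    unfolding L_def r_def by (rule not_stop_step_length[OF assms(2,3)])
  then have r: "r > 0"
    using \<delta>_pos L(1) by (meson less_trans zero_less_mult_pos)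
  have "r \<in> \<Gamma>"
    unfolding r_def using mem assms(1) Q_subset by (intro distance_in_Gamma) auto
  have "sig r \<le> L * r\<^sup>2 / 4"
  proof (cases "\<rho> \<le> r")
    case True
    then have "sig r \<le> E * r\<^sup>2 / \<rho>\<^sup>2"
      using sig_subquadratic[OF \<rho>_pos True \<open>r \<in> \<Gamma>\<close>] \<rho>_pos by (simp add: E_def field_simps)
    also have "\<dots> = \<gamma> * r\<^sup>2 / 4"
      by (simp add: \<gamma>_def)
    also have "\<dots> \<le> L * r\<^sup>2 / 4"
      using L r by simp
    finally show ?thesis .
  next
    case False
    then have "sig r \<le> E"
      unfolding E_def using r by (intro sig_mono \<rho>_Gamma) auto
    then show ?thesis
      using long_step[OF assms(2,3,5)] by (simp add: L_def r_def)
  qed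
  moreover have "0 \<le> L * r\<^sup>2"
    using L by simp
  ultimately have "L / 4 * r\<^sup>2 \<le> f x - f (step L x)"
    using descent model by simp
  then show ?thesis
    by (simp add: ggm_accept_iff L_def r_def)
qed

lemma accepted_decrease:
  assumes "M > 0" "\<not> ggm_stop B Q f df \<delta> x M i" "ggm_accept B Q f df x M i"
    and "2 ^ i * M \<le> 2 * \<gamma>"
  shows "f (step (2 ^ i * M) x) < f x - E"
  using long_step[OF assms(1,2,4)] assms(3) by (simp add: ggm_accept_iff)

text \<open>
  The bound \<open>2 \<gamma>\<close> on the trial constant survives a rejection, since only trials with constant at most
  \<open>\<gamma>\<close> are rejected; it yields \<open>M \<le> \<gamma>\<close> after an acceptance, where the constant is halved. Strictness of
  the decrease for \<open>k > 0\<close> matters in the end: after \<open>N\<close> iterations the bound \<open>f x0 - N E\<close> is the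
  infimum itself.
\<close>

lemma reach_invariant:
  assumes "ggm_reach B Q f df \<delta> x0 M0 k i x M" "x0 \<in> Q" "0 < M0" "M0 \<le> \<gamma>"
  shows "x \<in> Q \<and> 0 < M \<and> M \<le> \<gamma> \<and> 2 ^ i * M \<le> 2 * \<gamma>
    \<and> f x \<le> f x0 - real k * E \<and> (k > 0 \<longrightarrow> f x < f x0 - real k * E)"
  using assms(1)
proof induction
  case start
  then show ?case
    using assms \<gamma>_pos by simp
next
  case (retry k i x M)
  then have "\<not> \<gamma> < 2 ^ i * M"
    using trial_accepted by blast
  with retry.IH show ?case by simp
next
  case (advance k i x M)
  then have "f (step (2 ^ i * M) x) < f x - E"
    by (intro accepted_decrease) auto
  moreover have "step (2 ^ i * M) x \<in> Q"
    using advance.IH by (intro grad_step_mem closed_Q) auto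
  ultimately show ?case
    using advance.IH \<gamma>_pos by (auto simp: power_int_diff algebra_simps)
qed

text \<open>
  Otherwise the inner loop would double the trial constant forever, against its bound \<open>2 \<gamma>\<close>.
\<close>

lemma stops_or_next:
  assumes "ggm_reach B Q f df \<delta> x0 M0 k 0 x M" "x0 \<in> Q" "0 < M0" "M0 \<le> \<gamma>"
    and no_stop: "\<not> ggm_stops_at B Q f df \<delta> x0 M0 k"
  shows "\<exists>x M. ggm_reach B Q f df \<delta> x0 M0 (Suc k) 0 x M"
proof (rule ccontr)
  assume stuck: "\<not> ?thesis"
  have reach: "ggm_reach B Q f df \<delta> x0 M0 k i x M" for i
  proof (induction i)
    case (Suc i)
    have "\<not> ggm_stop B Q f df \<delta> x M i"
      using no_stop Suc unfolding ggm_stops_at_def by blast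
    moreover from this have "\<not> ggm_accept B Q f df x M i"
      using stuck ggm_reach.advance[OF Suc] by blast
    ultimately show ?case
      by (rule ggm_reach.retry[OF Suc])
  qed (rule assms(1))
  have "M > 0"
    using reach_invariant[OF reach[of 0] assms(2-4)] by simp
  obtain i where "2 * \<gamma> / M < 2 ^ i"
    using real_arch_pow[of 2 "2 * \<gamma> / M"] by auto
  then have "2 * \<gamma> < 2 ^ i * M"
    using \<open>M > 0\<close> by (simp add: field_simps)
  moreover have "2 ^ i * M \<le> 2 * \<gamma>"
    using reach_invariant[OF reach[of i] assms(2-4)] by blast
  ultimately show False by simp
qed

lemma stops_within:
  assumes "x0 \<in> Q" "0 < M0" "M0 \<le> \<gamma>" "N > 0"
    and below: "\<And>x. x \<in> Q \<Longrightarrow> f x0 - real N * E \<le> f x"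
  shows "\<exists>k\<le>N. ggm_stops_at B Q f df \<delta> x0 M0 k"
proof (rule ccontr)
  assume no_stop: "\<not> ?thesis"
  have "k \<le> N \<Longrightarrow> \<exists>x M. ggm_reach B Q f df \<delta> x0 M0 k 0 x M" for k
  proof (induction k)
    case 0
    show ?case
      using ggm_reach.start by blast
  next
    case (Suc k)
    then obtain x M where "ggm_reach B Q f df \<delta> x0 M0 k 0 x M"
      by auto
    moreover have "\<not> ggm_stops_at B Q f df \<delta> x0 M0 k"
      using no_stop Suc.prems by auto
    ultimately show ?case
      using stops_or_next assms(1-3) by blast
  qed
  then obtain x M where "ggm_reach B Q f df \<delta> x0 M0 N 0 x M"
    by blast
  then have "x \<in> Q" "f x < f x0 - real N * E"
    using reach_invariant[OF _ assms(1-3)] assms(4) by auto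
  with below show False
    by fastforce
qed

end

theorem theorem3:
  fixes B :: "'a::euclidean_space \<Rightarrow> 'a \<Rightarrow>\<^sub>L real"
    and D Q :: "'a set"
    and f :: "'a \<Rightarrow> real"
    and df :: "'a \<Rightarrow> 'a \<Rightarrow>\<^sub>L real"
    and x0 :: 'a
    and M0 \<delta> f_star \<Delta>0 \<epsilon>N :: real
    and N :: nat
  assumes "positive_definite_op B"
    and "convex D"
    and "\<not> affine_fun_on D f"
    and "\<And>x. x \<in> D \<Longrightarrow> (f has_derivative blinfun_apply (df x)) (at x within D)"
    and "regularity_assumption B D f"
    and "Q \<subseteq> D" and "closed Q" and "convex Q"
    and "bdd_below (f ` Q)" and "f_star = (INF x\<in>Q. f x)"
    and "x0 \<in> Q" and "M0 > 0" and "\<delta> > 0"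
    and "\<Delta>0 = f x0 - f_star" and "\<epsilon>N = 2 * \<Delta>0 / real N"
    and "\<Delta>0 > 0" and "\<Delta>0 \<in> gamma_dom B D f" and "\<epsilon>N \<in> gamma_dom B D f"
    and "2 powr (5 / 2) * (\<Delta>0 / (real N * \<delta>)) \<in> Gamma_set B D"
    and "M0 \<le> gamma_hat B D f \<Delta>0"
    and "N = 1 \<Longrightarrow> M0 \<le> gamma_hat B D f \<epsilon>N"
    and "N \<ge> 1"
    and "\<Delta>0 > real N * sigma_hat B D f (2 powr (5 / 2) * (\<Delta>0 / (real N * \<delta>)))"
  shows "\<exists>kbar\<le>N. ggm_stops_at B Q f df \<delta> x0 M0 kbar \<and>
           (\<forall>k\<le>kbar. \<forall>i x M. ggm_reach B Q f df \<delta> x0 M0 k i x M \<longrightarrow> M \<le> gamma_hat B D f \<epsilon>N)"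
proof -
  interpret curvature_bound B D f df
    by unfold_locales (fact assms)+
  define R where "R = 2 powr (5 / 2) * (\<Delta>0 / (real N * \<delta>))"
  obtain \<rho> where \<rho>: "\<rho> \<in> \<Gamma>" "\<epsilon>N = 2 * sig \<rho>"
    using \<open>\<epsilon>N \<in> gamma_dom B D f\<close> by (auto simp: gamma_dom_def sigma_hat_eq_sig)
  have N: "real N > 0"
    using \<open>N \<ge> 1\<close> by simp
  have sig_\<rho>: "sig \<rho> = \<Delta>0 / real N"
    using \<rho>(2) \<open>\<epsilon>N = 2 * \<Delta>0 / real N\<close> by simp
  have "R \<ge> 0"
    using \<open>\<Delta>0 > 0\<close> \<open>\<delta> > 0\<close> by (simp add: R_def)
  have "real N * sig R < \<Delta>0"
    using \<open>\<Delta>0 > real N * _\<close> by (simp add: R_def sigma_hat_eq_sig)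
  then have "sig R < sig \<rho>"
    using N by (simp add: sig_\<rho> field_simps)
  then have "R < \<rho>"
    using sig_mono[of \<rho> R] Gamma_nonneg[OF \<rho>(1)] assms(19) by (fold R_def) force
  have "R * \<delta> = 2 powr (5 / 2) * sig \<rho>"
    using \<open>\<delta> > 0\<close> by (simp add: R_def sig_\<rho> field_simps)
  then have "(R * \<delta>)\<^sup>2 = (2 powr (5 / 2))\<^sup>2 * (sig \<rho>)\<^sup>2"
    by (simp add: power_mult_distrib)
  \<comment> \<open>the constant \<open>32 = 2 \<cdot> 16\<close>: a trial constant up to \<open>2 \<gamma>\<close>, the factor \<open>4\<close> of the acceptance test,
     and the factor \<open>4\<close> in \<open>\<gamma> = 4 E/\<rho>\<^sup>2\<close>\<close>
  also have "(2 powr (5 / 2))\<^sup>2 = (32::real)"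
    by (simp add: power2_eq_square flip: powr_add)
  finally have "32 * (sig \<rho>)\<^sup>2 = R\<^sup>2 * \<delta>\<^sup>2"
    by (simp add: power_mult_distrib)
  also have "\<dots> < \<delta>\<^sup>2 * \<rho>\<^sup>2"
    using \<open>R \<ge> 0\<close> \<open>R < \<rho>\<close> \<open>\<delta> > 0\<close> by (simp add: mult.commute power_strict_mono)
  finally have large: "32 * (sig \<rho>)\<^sup>2 < \<delta>\<^sup>2 * \<rho>\<^sup>2" .
  interpret ggm_analysis B D f df Q \<delta> \<rho>
    by unfold_locales (use assms \<rho> large \<open>R \<ge> 0\<close> \<open>R < \<rho>\<close> in auto)
  have \<gamma>_eq: "gamma_hat B D f \<epsilon>N = \<gamma>"
    using gamma_hat_sig[OF \<rho>(1)] by (simp add: \<rho>(2) \<gamma>_def E_def)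
  have "M0 \<le> \<gamma>"
  proof (cases "N = 1")
    case True
    then show ?thesis
      \<comment> \<open>here \<open>\<epsilon>N = 2 \<Delta>0\<close> exceeds \<open>\<Delta>0\<close>, so monotonicity of \<open>gamma_hat\<close> does not help\<close>
      using assms(21) \<gamma>_eq by simp
  next
    case False
    then have "2 \<le> real N"
      using \<open>N \<ge> 1\<close> by simp
    then have "\<Delta>0 * 2 \<le> \<Delta>0 * real N"
      using \<open>\<Delta>0 > 0\<close> by (intro mult_left_mono) auto
    then have "\<epsilon>N \<le> \<Delta>0"
      unfolding \<open>\<epsilon>N = 2 * \<Delta>0 / real N\<close> using N
      by (simp add: pos_divide_le_eq mult.commute)
    then have "gamma_hat B D f \<Delta>0 \<le> gamma_hat B D f \<epsilon>N"
      using assms E_pos \<rho>(2) by (intro gamma_hat_antimono) (auto simp: E_def)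
    then show ?thesis
      using \<open>M0 \<le> gamma_hat B D f \<Delta>0\<close> \<gamma>_eq by simp
  qed
  have "f x0 - real N * E \<le> f x" if "x \<in> Q" for x
  proof -
    have "f_star \<le> f x"
      unfolding \<open>f_star = _\<close> using that \<open>bdd_below (f ` Q)\<close> by (rule cINF_lower[rotated])
    then show ?thesis
      using N \<open>\<Delta>0 = f x0 - f_star\<close> by (simp add: E_def sig_\<rho>)
  qed
  then obtain k where "k \<le> N" "ggm_stops_at B Q f df \<delta> x0 M0 k"
    using stops_within[OF \<open>x0 \<in> Q\<close> \<open>M0 > 0\<close> \<open>M0 \<le> \<gamma>\<close>, of N] N by auto
  moreover have "M \<le> \<gamma>" if "ggm_reach B Q f df \<delta> x0 M0 j i x M" for j i x M
    using reach_invariant[OF that \<open>x0 \<in> Q\<close> \<open>M0 > 0\<close> \<open>M0 \<le> \<gamma>\<close>] by blast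
  ultimately show ?thesis
    unfolding \<gamma>_eq by blast
qed

end
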